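(* Let $n\in\mathbb{N}$ be arbitrary. The characteristic polynomial of the Laplacian matrix of the enhanced power graph $\mathcal{P}_e(Q_{4n})$ of the generalized quaternion group $Q_{4n}$ is \[\Phi(L(\mathcal{P}_e(Q_{4n})),x)=x(x-4n)^2(x-4)^{n}(x-2)^{n}(x-2n)^{2n-3}.\]
   Context: The generalized quaternion group of order $4n$ is $Q_{4n}=\langle a,b : a^{2n}=e,\ a^n=b^2,\ ab=ba^{-1}\rangle$. The enhanced power graph $\mathcal{P}_e(G)$ of a group $G$ is the simple undirected graph with vertex set $G$ in which two distinct vertices $x,y$ are adjacent if and only if $x,y\in\langle z\rangle$ for some $z\in G$. The Laplacian matrix of a finite simple graph $\Gamma$ is $L(\Gamma)=D(\Gamma)-A(\Gamma)$, where $A(\Gamma)$ is the adjacency matrix and $D(\Gamma)$ the diagonal matrix of vertex degrees. $\Phi(L(\Gamma),x)=\det(xI-L(\Gamma))$ is its characteristic polynomial. *)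

theory Defs
  imports
    "HOL-Algebra.Generated_Groups"
    "HOL-Computational_Algebra.Polynomial_Factorial"
    "Jordan_Normal_Form.Char_Poly"
begin

section \<open>Groups given by generators and relations\<close>

text \<open>A letter \<open>(g, False)\<close> stands for the generator \<open>g\<close>, and \<open>(g, True)\<close> for its formal inverse.\<close>

type_synonym 'g gword = "('g \<times> bool) list"

text \<open>The congruence on words generated by free cancellation and by the relations
  \<open>u = v\<close> for \<open>(u, v) \<in> R\<close>. Its classes form the quotient of the free
  group by the normal closure of all \<open>u v\<^sup>-\<^sup>1\<close>.\<close>

inductive pcong :: "('g gword \<times> 'g gword) set \<Rightarrow> 'g gword \<Rightarrow> 'g gword \<Rightarrow> bool"
  for R where
  refl: "pcong R u u"
| sym: "pcong R u v \<Longrightarrow> pcong R v u"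
| trans: "pcong R u v \<Longrightarrow> pcong R v w \<Longrightarrow> pcong R u w"
| ctxt: "pcong R u v \<Longrightarrow> pcong R (x @ u @ y) (x @ v @ y)"
| cancel: "pcong R [(g, s), (g, \<not> s)] []"
| relator: "(u, v) \<in> R \<Longrightarrow> pcong R u v"

definition pclass :: "('g gword \<times> 'g gword) set \<Rightarrow> 'g gword \<Rightarrow> 'g gword set" where
  "pclass R u = {w. pcong R u w}"

definition presented_group :: "('g gword \<times> 'g gword) set \<Rightarrow> 'g gword set monoid" where
  "presented_group R =
     \<lparr>carrier = range (pclass R),
      monoid.mult = (\<lambda>X Y. {w. \<exists>u\<in>X. \<exists>v\<in>Y. pcong R (u @ v) w}),
      one = pclass R []\<rparr>"

section \<open>Generalized quaternion groups\<close>

datatype quat_gen = Gen_a | Gen_b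

definition quat_rels :: "nat \<Rightarrow> (quat_gen gword \<times> quat_gen gword) set" where
  "quat_rels n =
     (let a = (Gen_a, False); b = (Gen_b, False); a' = (Gen_a, True)
      in {(replicate (2 * n) a, []), (replicate n a, [b, b]), ([a, b], [b, a'])})"

definition quaternion_group :: "nat \<Rightarrow> quat_gen gword set monoid" where
  "quaternion_group n = presented_group (quat_rels n)"

section \<open>Enhanced power graph and Laplacian matrix\<close>

text \<open>The vertex set of the graph is \<open>carrier G\<close>.\<close>

definition enhanced_power_adj :: "('a, 'b) monoid_scheme \<Rightarrow> 'a \<Rightarrow> 'a \<Rightarrow> bool" where
  "enhanced_power_adj G x y \<longleftrightarrow>
     x \<in> carrier G \<and> y \<in> carrier G \<and> x \<noteq> y \<and>
     (\<exists>z\<in>carrier G. x \<in> generate G {z} \<and> y \<in> generate G {z})"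

text \<open>The matrices of a finite simple graph with adjacency relation \<open>adj\<close>, whose vertices are
  listed without repetition in \<open>vs\<close>; the list fixes the order of the rows and columns.\<close>

definition adjacency_mat :: "'v list \<Rightarrow> ('v \<Rightarrow> 'v \<Rightarrow> bool) \<Rightarrow> real mat" where
  "adjacency_mat vs adj =
     mat (length vs) (length vs) (\<lambda>(i, j). if adj (vs ! i) (vs ! j) then 1 else 0)"

definition degree_mat :: "'v list \<Rightarrow> ('v \<Rightarrow> 'v \<Rightarrow> bool) \<Rightarrow> real mat" where
  "degree_mat vs adj =
     mat (length vs) (length vs)
       (\<lambda>(i, j). if i = j then real (card {w \<in> set vs. adj (vs ! i) w}) else 0)"

definition laplacian_mat :: "'v list \<Rightarrow> ('v \<Rightarrow> 'v \<Rightarrow> bool) \<Rightarrow> real mat" where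
  "laplacian_mat vs adj = degree_mat vs adj - adjacency_mat vs adj"

section \<open>The presentation defines a group; the quaternion group has order \<open>4n\<close>\<close>

lemma pcong_append:
  assumes "pcong R u u'" "pcong R v v'"
  shows "pcong R (u @ v) (u' @ v')"
  using pcong.ctxt[OF assms(1), of "[]" v] pcong.ctxt[OF assms(2), of u' "[]"]
  by (auto intro: pcong.trans)

lemma pclass_eq_iff: "pclass R u = pclass R v \<longleftrightarrow> pcong R u v"
  unfolding pclass_def by (auto intro: pcong.refl pcong.sym pcong.trans)

lemma presented_group_mult:
  "pclass R u \<otimes>\<^bsub>presented_group R\<^esub> pclass R v = pclass R (u @ v)"
  unfolding presented_group_def pclass_def
  by (auto intro: pcong.refl pcong.trans pcong_append)

definition winv :: "'g gword \<Rightarrow> 'g gword" where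
  "winv u = rev (map (\<lambda>(g, s). (g, \<not> s)) u)"

lemma pcong_winv: "pcong R (winv u @ u) []"
proof (induction u)
  case Nil
  then show ?case by (simp add: winv_def pcong.refl)
next
  case (Cons x u)
  obtain g s where x: "x = (g, s)" by force
  have "pcong R (winv u @ [(g, \<not> s), (g, \<not> \<not> s)] @ u) (winv u @ [] @ u)"
    by (intro pcong.ctxt pcong.cancel)
  with Cons show ?case by (auto simp: winv_def x intro: pcong.trans)
qed

lemma group_presented_group: "group (presented_group R)"
proof (rule groupI)
  fix x assume "x \<in> carrier (presented_group R)"
  then obtain u where u: "x = pclass R u" by (auto simp: presented_group_def)
  have "pclass R (winv u) \<otimes>\<^bsub>presented_group R\<^esub> x = \<one>\<^bsub>presented_group R\<^esub>"
    unfolding u presented_group_mult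
    by (simp add: presented_group_def pclass_eq_iff pcong_winv)
  then show "\<exists>y\<in>carrier (presented_group R).
      y \<otimes>\<^bsub>presented_group R\<^esub> x = \<one>\<^bsub>presented_group R\<^esub>"
    by (auto simp: presented_group_def)
next
  fix x y z
  assume "x \<in> carrier (presented_group R)" "y \<in> carrier (presented_group R)"
    "z \<in> carrier (presented_group R)"
  then obtain u v w where "x = pclass R u" "y = pclass R v" "z = pclass R w"
    by (auto simp: presented_group_def)
  then show "x \<otimes>\<^bsub>presented_group R\<^esub> y \<otimes>\<^bsub>presented_group R\<^esub> z
      = x \<otimes>\<^bsub>presented_group R\<^esub> (y \<otimes>\<^bsub>presented_group R\<^esub> z)"
    by (simp add: presented_group_mult)
next
  fix x y
  assume "x \<in> carrier (presented_group R)" "y \<in> carrier (presented_group R)"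
  then obtain u v where "x = pclass R u" "y = pclass R v"
    by (auto simp: presented_group_def)
  then have "x \<otimes>\<^bsub>presented_group R\<^esub> y = pclass R (u @ v)"
    by (simp add: presented_group_mult)
  then show "x \<otimes>\<^bsub>presented_group R\<^esub> y \<in> carrier (presented_group R)"
    by (simp add: presented_group_def)
next
  show "\<one>\<^bsub>presented_group R\<^esub> \<in> carrier (presented_group R)"
    by (simp add: presented_group_def)
next
  fix x assume "x \<in> carrier (presented_group R)"
  then obtain u where "x = pclass R u" by (auto simp: presented_group_def)
  moreover have "\<one>\<^bsub>presented_group R\<^esub> = pclass R []" by (simp add: presented_group_def)
  ultimately show "\<one>\<^bsub>presented_group R\<^esub> \<otimes>\<^bsub>presented_group R\<^esub> x = x"
    by (simp add: presented_group_mult)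
qed

text \<open>Every word is congruent to some \<open>a\<^sup>i\<close> or \<open>a\<^sup>i b\<close> with \<open>i < 2n\<close>.\<close>

definition qnf :: "nat \<times> bool \<Rightarrow> quat_gen gword" where
  "qnf p = replicate (fst p) (Gen_a, False) @ (if snd p then [(Gen_b, False)] else [])"

definition has_qnf :: "nat \<Rightarrow> quat_gen gword \<Rightarrow> bool" where
  "has_qnf n w \<longleftrightarrow> (\<exists>p\<in>{..<2 * n} \<times> UNIV. pcong (quat_rels n) w (qnf p))"

lemma quat_rel1: "pcong (quat_rels n) (replicate (2 * n) (Gen_a, False)) []"
  and quat_rel2: "pcong (quat_rels n) (replicate n (Gen_a, False)) [(Gen_b, False), (Gen_b, False)]"
  and quat_rel3: "pcong (quat_rels n) [(Gen_a, False), (Gen_b, False)] [(Gen_b, False), (Gen_a, True)]"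
  by (rule pcong.relator; simp add: quat_rels_def Let_def)+

lemma has_qnf_cong: "pcong (quat_rels n) u v \<Longrightarrow> has_qnf n v \<Longrightarrow> has_qnf n u"
  unfolding has_qnf_def by (blast intro: pcong.trans)

lemma has_qnf_a_power:
  assumes "n > 0"
  shows "has_qnf n (qnf (k, t))"
proof (induction k rule: less_induct)
  case (less k)
  show ?case
  proof (cases "k < 2 * n")
    case True
    then show ?thesis unfolding has_qnf_def by (auto intro!: bexI[of _ "(k, t)"] pcong.refl)
  next
    case False
    then have "qnf (k, t) = replicate (2 * n) (Gen_a, False) @ qnf (k - 2 * n, t)"
      by (auto simp: qnf_def simp flip: replicate_add append_assoc)
    moreover have "pcong (quat_rels n) (replicate (2 * n) (Gen_a, False) @ qnf (k - 2 * n, t))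
        ([] @ qnf (k - 2 * n, t))"
      by (intro pcong_append quat_rel1 pcong.refl)
    moreover have "has_qnf n (qnf (k - 2 * n, t))" using less assms False by auto
    ultimately show ?thesis by (auto intro: has_qnf_cong)
  qed
qed

lemma has_qnf_a_inv:
  assumes "n > 0" "has_qnf n w"
  shows "has_qnf n ((Gen_a, True) # w)"
proof -
  obtain i t where w: "pcong (quat_rels n) w (qnf (i, t))"
    using assms(2) unfolding has_qnf_def by auto
  define k where "k = 2 * n + i - 1"
  have k: "replicate (2 * n) (Gen_a, False) @ qnf (i, t) = (Gen_a, False) # qnf (k, t)"
    using assms(1) by (auto simp: qnf_def k_def simp flip: replicate_add append_assoc replicate_Suc append_Cons)
  have "pcong (quat_rels n) ([(Gen_a, True)] @ w) ([(Gen_a, True)] @ qnf (i, t))"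
    by (intro pcong_append w pcong.refl)
  moreover have "pcong (quat_rels n) ([(Gen_a, True)] @ qnf (i, t))
      ([(Gen_a, True)] @ replicate (2 * n) (Gen_a, False) @ qnf (i, t))"
    by (rule pcong.sym) (rule pcong.ctxt[of _ _ "[]", simplified], rule quat_rel1)
  moreover have "pcong (quat_rels n) ([(Gen_a, True), (Gen_a, \<not> True)] @ qnf (k, t)) ([] @ qnf (k, t))"
    by (intro pcong_append pcong.cancel pcong.refl)
  ultimately have "pcong (quat_rels n) ((Gen_a, True) # w) (qnf (k, t))"
    unfolding k by (auto intro: pcong.trans)
  then show ?thesis using has_qnf_a_power[OF assms(1)] by (rule has_qnf_cong)
qed

lemma quat_b_a: "pcong (quat_rels n) [(Gen_b, False), (Gen_a, False)] [(Gen_a, True), (Gen_b, False)]"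
proof -
  let ?a = "(Gen_a, False)" and ?A = "(Gen_a, True)" and ?b = "(Gen_b, False)"
  have "pcong (quat_rels n) ([] @ [?A, ?a] @ [?b, ?a]) ([] @ [] @ [?b, ?a])"
    using pcong.cancel[of _ Gen_a True] by (intro pcong.ctxt) simp
  moreover have "pcong (quat_rels n) ([?A] @ [?a, ?b] @ [?a]) ([?A] @ [?b, ?A] @ [?a])"
    by (intro pcong.ctxt quat_rel3)
  moreover have "pcong (quat_rels n) ([?A, ?b] @ [?A, ?a] @ []) ([?A, ?b] @ [] @ [])"
    using pcong.cancel[of _ Gen_a True] by (intro pcong.ctxt) simp
  ultimately show ?thesis by (auto intro: pcong.sym pcong.trans)
qed

lemma has_qnf_b:
  assumes "n > 0" "has_qnf n w"
  shows "has_qnf n ((Gen_b, False) # w)"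
proof -
  let ?b = "(Gen_b, False)"
  obtain i t where w: "pcong (quat_rels n) w (qnf (i, t))"
    using assms(2) unfolding has_qnf_def by auto
  have *: "has_qnf n (?b # qnf (i, t))" for i
  proof (induction i)
    case 0
    show ?case
    proof (cases t)
      case True
      have "qnf (n, False) = replicate n (Gen_a, False)" by (simp add: qnf_def)
      then have "pcong (quat_rels n) [?b, ?b] (qnf (n, False))"
        using quat_rel2 pcong.sym by metis
      then have "has_qnf n [?b, ?b]" using has_qnf_a_power[OF assms(1)] by (rule has_qnf_cong)
      then show ?thesis using True by (simp add: qnf_def)
    next
      case False
      then show ?thesis using has_qnf_a_power[OF assms(1), of 0 True] by (simp add: qnf_def)
    qed
  next
    case (Suc i)
    have "pcong (quat_rels n) ([?b, (Gen_a, False)] @ qnf (i, t)) ([(Gen_a, True), ?b] @ qnf (i, t))"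
      by (intro pcong_append quat_b_a pcong.refl)
    then have "pcong (quat_rels n) (?b # qnf (Suc i, t)) ((Gen_a, True) # ?b # qnf (i, t))"
      by (simp add: qnf_def)
    then show ?case using has_qnf_a_inv[OF assms(1) Suc] by (rule has_qnf_cong)
  qed
  have "pcong (quat_rels n) ([?b] @ w) ([?b] @ qnf (i, t))"
    by (intro pcong_append w pcong.refl)
  then show ?thesis using *[of i] by (auto intro: has_qnf_cong)
qed

lemma has_qnf:
  assumes "n > 0"
  shows "has_qnf n w"
proof (induction w)
  case Nil
  then show ?case using has_qnf_a_power[OF assms, of 0 False] by (simp add: qnf_def)
next
  case (Cons x w)
  let ?a = "(Gen_a, False)" and ?b = "(Gen_b, False)"
  consider "x = ?a" | "x = (Gen_a, True)" | "x = ?b" | "x = (Gen_b, True)"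
    by (metis (full_types) prod.exhaust quat_gen.exhaust)
  then show ?case
  proof cases
    case 1
    obtain i t where w: "pcong (quat_rels n) w (qnf (i, t))"
      using Cons unfolding has_qnf_def by auto
    have "pcong (quat_rels n) ([?a] @ w) ([?a] @ qnf (i, t))"
      by (intro pcong_append w pcong.refl)
    then have "pcong (quat_rels n) (x # w) (qnf (Suc i, t))" by (simp add: 1 qnf_def)
    then show ?thesis using has_qnf_a_power[OF assms] by (rule has_qnf_cong)
  next
    case 2
    then show ?thesis using has_qnf_a_inv[OF assms Cons] by simp
  next
    case 3
    then show ?thesis using has_qnf_b[OF assms Cons] by simp
  next
    case 4
    have "pcong (quat_rels n) (replicate n ?a @ replicate n ?a) ([?b, ?b] @ [?b, ?b])"
      by (intro pcong_append quat_rel2)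
    moreover have "replicate n ?a @ replicate n ?a = replicate (2 * n) ?a"
      by (simp add: mult_2 replicate_add)
    ultimately have "pcong (quat_rels n) [] [?b, ?b, ?b, ?b]"
      using quat_rel1[of n] by (auto intro: pcong.sym pcong.trans)
    then have "pcong (quat_rels n) ([x] @ [] @ w) ([x] @ [?b, ?b, ?b, ?b] @ w)"
      by (rule pcong.ctxt)
    moreover have "pcong (quat_rels n) ([(Gen_b, True), (Gen_b, \<not> True)] @ [?b, ?b, ?b] @ w)
        ([] @ [?b, ?b, ?b] @ w)"
      by (intro pcong_append pcong.cancel pcong.refl)
    ultimately have "pcong (quat_rels n) (x # w) (?b # ?b # ?b # w)"
      by (auto simp: 4 intro: pcong.trans)
    then show ?thesis by (rule has_qnf_cong) (intro has_qnf_b assms Cons)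
  qed
qed

text \<open>The normal forms are pairwise incongruent: words act on pairs \<open>(i, j)\<close>, thought of as
  \<open>a\<^sup>i b\<^sup>j\<close>, in the way left multiplication does.\<close>

fun qact :: "nat \<Rightarrow> quat_gen \<times> bool \<Rightarrow> int \<times> bool \<Rightarrow> int \<times> bool" where
  "qact n (Gen_a, False) (i, j) = ((i + 1) mod (2 * int n), j)"
| "qact n (Gen_a, True) (i, j) = ((i - 1) mod (2 * int n), j)"
| "qact n (Gen_b, False) (i, j) = ((if j then int n - i else - i) mod (2 * int n), \<not> j)"
| "qact n (Gen_b, True) (i, j) = ((if j then - i else int n - i) mod (2 * int n), \<not> j)"

definition qdom :: "nat \<Rightarrow> (int \<times> bool) set" where
  "qdom n = {0..<2 * int n} \<times> UNIV"

lemma qact_dom: "n > 0 \<Longrightarrow> qact n x p \<in> qdom n"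
  by (cases "(n, x, p)" rule: qact.cases) (auto simp: qdom_def)

lemma qact_foldr_dom: "n > 0 \<Longrightarrow> p \<in> qdom n \<Longrightarrow> foldr (qact n) w p \<in> qdom n"
  by (induction w) (auto intro: qact_dom)

lemma qact_cancel:
  assumes "p \<in> qdom n"
  shows "qact n (g, s) (qact n (g, \<not> s) p) = p"
  using assms by (cases p; cases g; cases s) (auto simp: qdom_def mod_simps)

lemma qact_a_power:
  "p \<in> qdom n \<Longrightarrow> (qact n (Gen_a, False) ^^ k) p
     = ((fst p + int k) mod (2 * int n), snd p)"
  by (induction k) (auto simp: qdom_def mod_simps algebra_simps)

lemma qact_b_b:
  assumes "p \<in> qdom n"
  shows "qact n (Gen_b, False) (qact n (Gen_b, False) p) = ((fst p + int n) mod (2 * int n), snd p)"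
proof (cases p)
  case (Pair i j)
  have "(i - int n + 2 * int n) mod (2 * int n) = (i - int n) mod (2 * int n)"
    by (rule mod_add_self2)
  moreover have "i - int n + 2 * int n = int n + i" by simp
  ultimately have "(i - int n) mod (2 * int n) = (int n + i) mod (2 * int n)" by simp
  then show ?thesis by (auto simp: Pair mod_simps algebra_simps)
qed

lemma qact_a_b:
  "qact n (Gen_a, False) (qact n (Gen_b, False) p) = qact n (Gen_b, False) (qact n (Gen_a, True) p)"
  by (cases p) (auto simp: mod_simps algebra_simps)

lemma pcong_imp_qact_eq:
  assumes "pcong (quat_rels n) u v" "n > 0" "p \<in> qdom n"
  shows "foldr (qact n) u p = foldr (qact n) v p"
  using assms
proof (induction arbitrary: p rule: pcong.induct)
  case (ctxt u v x y)
  then show ?case by (simp add: qact_foldr_dom)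
next
  case (cancel g s)
  then show ?case by (simp add: qact_cancel)
next
  case (relator u v)
  then show ?case
    by (auto simp: quat_rels_def Let_def qact_a_power qact_b_b qact_a_b)
       (auto simp: qdom_def)
qed auto

lemma card_quaternion_group:
  assumes "n > 0"
  shows "card (carrier (quaternion_group n)) = 4 * n"
proof -
  let ?P = "{..<2 * n} \<times> (UNIV :: bool set)" and ?f = "\<lambda>p. pclass (quat_rels n) (qnf p)"
  have "carrier (quaternion_group n) = ?f ` ?P"
    using has_qnf[OF assms] unfolding quaternion_group_def presented_group_def has_qnf_def
    by (auto simp: image_iff pclass_eq_iff)
  moreover have "inj_on ?f ?P"
  proof (rule inj_onI)
    have *: "foldr (qact n) (qnf p) (0, False) = (int (fst p), snd p)" if "p \<in> ?P" for p
    proof -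
      have dom: "(0, b) \<in> qdom n" for b using assms by (simp add: qdom_def)
      show ?thesis using that dom by (auto simp: qnf_def qact_a_power)
    qed
    fix p q assume "p \<in> ?P" "q \<in> ?P" "?f p = ?f q"
    moreover have "(0, False) \<in> qdom n" using assms by (simp add: qdom_def)
    ultimately have "(int (fst p), snd p) = (int (fst q), snd q)"
      using pcong_imp_qact_eq[of n "qnf p" "qnf q" "(0, False)"] assms *[of p] *[of q]
      by (simp add: pclass_eq_iff)
    then show "p = q" by (simp add: prod_eq_iff)
  qed
  ultimately show ?thesis by (simp add: card_image)
qed

end

theory Submission
  imports Defs "HOL-Algebra.Multiplicative_Group"
begin

text \<open>Write \<open>a\<^sup>i\<close> and \<open>a\<^sup>i b\<close> for the elements of the group. The powers of \<open>a\<close> form a cyclic subgroup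
  of order \<open>2n\<close>, and each remaining element \<open>a\<^sup>i b\<close> squares to \<open>a\<^sup>n\<close>, so that it generates the
  four-element subgroup \<open>{e, a\<^sup>n, a\<^sup>i b, a\<^sup>i\<^sup>+\<^sup>n b}\<close> (\<open>generate_flip\<close>). Hence \<open>e\<close> and \<open>a\<^sup>n\<close> are
  adjacent to every other vertex of the enhanced power graph, and once these two are deleted the
  graph falls apart into a clique of \<open>2n - 2\<close> powers of \<open>a\<close> and \<open>n\<close> edges
  \<open>{a\<^sup>i b, a\<^sup>i\<^sup>+\<^sup>n b}\<close> (\<open>adj_rot_rot\<close>, \<open>adj_rot_flip\<close>, \<open>adj_flip_flip\<close>).

  Let \<open>\<Phi>(\<Gamma>, t)\<close> be the Laplacian characteristic polynomial of \<open>\<Gamma>\<close>. Deleting a dominating vertex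
  from a graph \<open>\<Gamma>\<close> on \<open>m\<close> vertices lowers all remaining degrees by one and gives the identity
  \<open>(t - 1) \<Phi>(\<Gamma>, t) = t (t - m) \<Phi>(\<Gamma> - v, t - 1)\<close> (\<open>lap_char_dominating\<close>). Used twice, it reduces
  the claim to \<open>(t - 2) \<Phi>(\<Gamma>, t) = t (t - 4n)\<^sup>2 \<Phi>(\<Gamma> - e - a\<^sup>n, t - 2)\<close>. Since \<open>\<Phi>\<close> is multiplicative over
  disjoint unions (\<open>lap_char_concat\<close>) and is known for cliques (\<open>lap_char_clique\<close>, by
  induction from the same deletion identity), the right-hand side splits into linear factors.\<close>

section \<open>Characteristic matrices of Laplacians\<close>

text \<open>This is \<open>t I - D + A\<close>. The vertices come as a list, so that graphs can be taken apart along
  list constructors, and the parameter \<open>t\<close> is an arbitrary ring element, so that the shift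
  \<open>t \<mapsto> t - 1\<close> in the deletion identity needs no substitution into polynomials.\<close>

definition lap_char_mat :: "'a::idom \<Rightarrow> ('v \<Rightarrow> 'v \<Rightarrow> bool) \<Rightarrow> 'v list \<Rightarrow> 'a mat" where
  "lap_char_mat t adj vs = mat (length vs) (length vs)
     (\<lambda>(i, j). (if i = j then t - of_nat (length (filter (adj (vs ! i)) vs)) else 0)
             + (if adj (vs ! i) (vs ! j) then 1 else 0))"

definition lap_char :: "'a::idom \<Rightarrow> ('v \<Rightarrow> 'v \<Rightarrow> bool) \<Rightarrow> 'v list \<Rightarrow> 'a" where
  "lap_char t adj vs = det (lap_char_mat t adj vs)"

lemma lap_char_mat_carrier [simp]:
  "lap_char_mat t adj vs \<in> carrier_mat (length vs) (length vs)"
  by (simp add: lap_char_mat_def)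

lemma lap_char_Nil [simp]: "lap_char t adj [] = 1"
  by (simp add: lap_char_def lap_char_mat_def det_def)

lemma char_poly_laplacian_mat:
  assumes "distinct vs"
  shows "char_poly (laplacian_mat vs adj) = lap_char [:0, 1:] adj vs"
proof -
  have deg: "card {w \<in> set vs. adj v w} = length (filter (adj v) vs)" for v
    using distinct_length_filter[OF assms, of "adj v"] by (simp add: Int_def conj_commute)
  have "char_poly_matrix (laplacian_mat vs adj) = lap_char_mat [:0, 1:] adj vs"
    by (rule eq_matI)
       (auto simp: char_poly_matrix_def laplacian_mat_def degree_mat_def adjacency_mat_def
          lap_char_mat_def deg of_nat_poly one_pCons)
  then show ?thesis by (simp add: char_poly_def lap_char_def)
qed

text \<open>Relabelling the vertices permutes rows and columns by the same permutation, whose sign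
  therefore enters twice.\<close>

lemma lap_char_mset_cong:
  assumes "mset vs = mset ws"
  shows "lap_char t adj vs = lap_char t adj ws"
proof -
  have len: "length vs = length ws" using assms by (rule mset_eq_length)
  obtain p where p: "p permutes {..<length ws}" and vs: "permute_list p ws = vs"
    using mset_eq_permutation[OF assms] .
  let ?k = "length ws"
  define M where "M = lap_char_mat t adj ws"
  have p': "p permutes {0..<?k}" using p by (simp add: lessThan_atLeast0)
  have lt: "p i < ?k" if "i < ?k" for i using permutes_in_image[OF p, of i] that by simp
  have inj: "p i = p j \<longleftrightarrow> i = j" for i j using permutes_inj[OF p] by (simp add: inj_eq)
  have deg: "length (filter P vs) = length (filter P ws)" for P
    using arg_cong[OF assms, of "\<lambda>M. size (filter_mset P M)"] by (metis mset_filter size_mset)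
  have nth: "vs ! i = ws ! p i" if "i < ?k" for i
    using permute_list_nth[OF p that] vs by simp
  define Mr where "Mr = mat ?k ?k (\<lambda>(i, j). M $$ (p i, j))"
  have M: "M \<in> carrier_mat ?k ?k" and Mr: "Mr \<in> carrier_mat ?k ?k"
    by (simp_all add: M_def Mr_def)
  have dMr: "det Mr = signof p * det M"
    unfolding Mr_def by (rule det_permute_rows[OF M p'])
  have "lap_char_mat t adj vs = transpose_mat (mat ?k ?k (\<lambda>(i, j). transpose_mat Mr $$ (p i, j)))"
    by (rule eq_matI) (auto simp: M_def Mr_def lap_char_mat_def deg len nth lt inj)
  then have "lap_char t adj vs = det (mat ?k ?k (\<lambda>(i, j). transpose_mat Mr $$ (p i, j)))"
    unfolding lap_char_def by (metis det_transpose mat_carrier)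
  also have "\<dots> = signof p * det (transpose_mat Mr)"
    by (rule det_permute_rows[OF _ p']) (use Mr in simp)
  also have "\<dots> = signof p * signof p * det M"
    by (simp add: det_transpose[OF Mr] dMr mult.assoc)
  also have "\<dots> = det M" by (simp add: sign_def)
  finally show ?thesis by (simp add: lap_char_def M_def)
qed

text \<open>The row \<open>(c, -1, \<dots>, -1)\<close> times the bordered matrix vanishes off the border, because the
  columns of \<open>A\<close> all sum to \<open>c\<close>; one left multiplication makes the matrix block triangular.\<close>

lemma det_bordered_ones:
  fixes A :: "'a::idom mat"
  assumes A: "A \<in> carrier_mat k k"
    and col_sum: "\<And>j. j < k \<Longrightarrow> (\<Sum>i<k. A $$ (i, j)) = c"
  shows "c * det (four_block_mat (mat 1 1 (\<lambda>_. d)) (mat 1 k (\<lambda>_. 1)) (mat k 1 (\<lambda>_. 1)) A)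
    = (c * d - of_nat k) * det A"
proof -
  define U where "U = four_block_mat (mat 1 1 (\<lambda>_. c)) (mat 1 k (\<lambda>_. - 1)) (0\<^sub>m k 1) (1\<^sub>m k)"
  define M where "M = four_block_mat (mat 1 1 (\<lambda>_. d)) (mat 1 k (\<lambda>_. 1)) (mat k 1 (\<lambda>_. 1)) A"
  have U: "U \<in> carrier_mat (1 + k) (1 + k)" and M: "M \<in> carrier_mat (1 + k) (1 + k)"
    unfolding U_def M_def using A by auto
  have detU: "det U = c"
    unfolding U_def
    by (subst det_four_block_mat_lower_left_zero[of _ 1 _ k]) (auto simp: det_single)
  have tl: "mat 1 1 (\<lambda>_. c) * mat 1 1 (\<lambda>_. d) + mat 1 k (\<lambda>_. - 1) * mat k 1 (\<lambda>_. 1)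
      = mat 1 1 (\<lambda>_. c * d - of_nat k)"
    by (rule eq_matI) (auto simp: scalar_prod_def)
  have tr: "mat 1 1 (\<lambda>_. c) * mat 1 k (\<lambda>_. 1) + mat 1 k (\<lambda>_. - 1) * A = 0\<^sub>m 1 k"
    by (rule eq_matI)
       (use A col_sum in \<open>auto simp: scalar_prod_def sum_negf lessThan_atLeast0\<close>)
  have "U * M = four_block_mat (mat 1 1 (\<lambda>_. c * d - of_nat k)) (0\<^sub>m 1 k) (mat k 1 (\<lambda>_. 1)) A"
    unfolding U_def M_def
    by (subst mult_four_block_mat[of _ 1 1 _ k _ k _ _ 1 _ k])
       (use A in \<open>auto simp: tl[simplified] tr[simplified]\<close>)
  then have "det (U * M) = (c * d - of_nat k) * det A"
    by (simp, subst det_four_block_mat_upper_right_zero[of _ 1 _ k]) (use A in \<open>auto simp: det_single\<close>)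
  then show ?thesis using det_mult[OF U M] detU by (simp add: M_def)
qed

text \<open>The columns of a Laplacian sum to zero, so those of \<open>t I - L\<close> sum to \<open>t\<close>.\<close>

lemma lap_char_mat_col_sum:
  fixes t :: "'a::idom"
  assumes sym: "\<And>x y. x \<in> set vs \<Longrightarrow> y \<in> set vs \<Longrightarrow> adj x y \<longleftrightarrow> adj y x"
    and j: "j < length vs"
  shows "(\<Sum>i<length vs. lap_char_mat t adj vs $$ (i, j)) = t"
proof -
  let ?k = "length vs" and ?d = "of_nat (length (filter (adj (vs ! j)) vs))"
  have "(\<Sum>i<?k. if adj (vs ! i) (vs ! j) then 1 else 0 :: 'a)
      = (\<Sum>i<?k. if adj (vs ! j) (vs ! i) then 1 else 0)"
    using j sym by (intro sum.cong) auto
  also have "\<dots> = ?d"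
    by (simp add: length_filter_conv_card sum.If_cases Int_def)
  finally have "(\<Sum>i<?k. if adj (vs ! i) (vs ! j) then 1 else 0 :: 'a) = ?d" .
  moreover have "(\<Sum>i<?k. if i = j then t - of_nat (length (filter (adj (vs ! i)) vs)) else 0) = t - ?d"
    using j by (simp add: sum.delta)
  ultimately show ?thesis
    using j by (simp add: lap_char_mat_def sum.distrib)
qed

text \<open>Every other vertex loses a neighbour with \<open>v\<close>, so the matrix is that of the smaller graph at
  \<open>t - 1\<close>, bordered by ones. Its column sums are \<open>t - 1\<close>, and the new factor is
  \<open>(t - 1) (t - k) - k = t (t - (k + 1))\<close> for \<open>k\<close> remaining vertices.\<close>

lemma lap_char_dominating:
  assumes sym: "\<And>x y. x \<in> set vs \<Longrightarrow> y \<in> set vs \<Longrightarrow> adj x y \<longleftrightarrow> adj y x"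
    and dom: "\<not> adj v v" "\<And>w. w \<in> set vs \<Longrightarrow> adj v w \<and> adj w v"
  shows "(t - 1) * lap_char t adj (v # vs)
    = t * (t - of_nat (length (v # vs))) * lap_char (t - 1) adj vs"
proof -
  let ?k = "length vs"
  define B where "B = lap_char_mat (t - 1) adj vs"
  have "filter (adj v) vs = vs" using dom by (simp add: filter_id_conv)
  then have "lap_char_mat t adj (v # vs) = four_block_mat (mat 1 1 (\<lambda>_. t - of_nat ?k))
      (mat 1 ?k (\<lambda>_. 1)) (mat ?k 1 (\<lambda>_. 1)) B"
    using dom
    by (intro eq_matI) (auto simp: lap_char_mat_def B_def nth_Cons' gr0_conv_Suc)
  moreover have "B \<in> carrier_mat ?k ?k" by (simp add: B_def)
  ultimately have "(t - 1) * lap_char t adj (v # vs)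
      = ((t - 1) * (t - of_nat ?k) - of_nat ?k) * det B"
    using det_bordered_ones[of B ?k "t - 1" "t - of_nat ?k"]
      lap_char_mat_col_sum[of vs adj _ "t - 1"] sym
    by (simp add: lap_char_def B_def)
  then show ?thesis by (simp add: lap_char_def B_def algebra_simps)
qed

text \<open>Without edges between the two parts the characteristic matrix is block diagonal.\<close>

lemma lap_char_append:
  assumes "\<And>x y. x \<in> set vs \<Longrightarrow> y \<in> set ws \<Longrightarrow> \<not> adj x y \<and> \<not> adj y x"
  shows "lap_char t adj (vs @ ws) = lap_char t adj vs * lap_char t adj ws"
proof -
  have [simp]: "filter (adj x) ws = []" if "x \<in> set vs" for x
    using assms that by (simp add: filter_empty_conv)
  have [simp]: "filter (adj y) vs = []" if "y \<in> set ws" for y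
    using assms that by (simp add: filter_empty_conv)
  have "lap_char_mat t adj (vs @ ws) = four_block_mat (lap_char_mat t adj vs)
      (0\<^sub>m (length vs) (length ws)) (0\<^sub>m (length ws) (length vs)) (lap_char_mat t adj ws)"
    using assms by (intro eq_matI) (auto simp: lap_char_mat_def nth_append)
  then show ?thesis
    unfolding lap_char_def
    by (simp, subst det_four_block_mat_lower_left_zero[of _ "length vs" _ "length ws"]) auto
qed

lemma lap_char_concat:
  assumes "sorted_wrt (\<lambda>xs ys. \<forall>x\<in>set xs. \<forall>y\<in>set ys. \<not> adj x y \<and> \<not> adj y x) xss"
  shows "lap_char t adj (concat xss) = (\<Prod>xs\<leftarrow>xss. lap_char t adj xs)"
  using assms
proof (induction xss)
  case (Cons xs xss)
  have "lap_char t adj (xs @ concat xss) = lap_char t adj xs * lap_char t adj (concat xss)"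
    using Cons.prems by (intro lap_char_append) auto
  then show ?case using Cons by simp
qed simp

text \<open>The factor \<open>t - k\<close> is left on both sides so that the empty clique, where the exponent in
  \<open>t (t - k)\<^sup>k\<^sup>-\<^sup>1\<close> would be negative, is covered too. The induction cancels \<open>t - 1\<close> and goes
  on with \<open>t - 1\<close> in place of \<open>t\<close>, so \<open>t\<close> has to avoid all natural numbers.\<close>

lemma lap_char_clique:
  fixes t :: "'a::idom"
  assumes "t \<notin> \<nat>" "distinct vs"
    and "\<And>x y. x \<in> set vs \<Longrightarrow> y \<in> set vs \<Longrightarrow> adj x y \<longleftrightarrow> x \<noteq> y"
  shows "(t - of_nat (length vs)) * lap_char t adj vs = t * (t - of_nat (length vs)) ^ length vs"
  using assms
proof (induction vs arbitrary: t)
  case (Cons v vs)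
  let ?k = "of_nat (length vs) :: 'a"
  have "t - 1 \<notin> \<nat>" using Cons.prems(1) Nats_add[of "t - 1" 1] by auto
  then have IH: "(t - 1 - ?k) * lap_char (t - 1) adj vs = (t - 1) * (t - 1 - ?k) ^ length vs"
    using Cons.prems by (intro Cons.IH) auto
  have "(t - 1) * lap_char t adj (v # vs) = t * (t - of_nat (length (v # vs))) * lap_char (t - 1) adj vs"
    using Cons.prems(2,3) by (intro lap_char_dominating) auto
  also have "t - of_nat (length (v # vs)) = t - 1 - ?k" by simp
  finally have "(t - 1) * lap_char t adj (v # vs) = (t - 1) * (t * (t - 1 - ?k) ^ length vs)"
    using IH by (simp add: mult_ac)
  moreover have "t - 1 \<noteq> 0" using Cons.prems(1) Nats_1 by auto
  ultimately have "lap_char t adj (v # vs) = t * (t - 1 - ?k) ^ length vs" by simp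
  then show ?case by (simp add: algebra_simps)
qed simp

section \<open>Cyclic subgroups of the generalized quaternion group\<close>

text \<open>In the quaternion group of order \<open>4n\<close>, \<open>rot n i\<close> is \<open>a\<^sup>i\<close> and \<open>flip n i\<close> is \<open>a\<^sup>i b\<close>. Exponents
  are not reduced modulo \<open>2n\<close>.\<close>

definition rot :: "nat \<Rightarrow> nat \<Rightarrow> quat_gen gword set" where
  "rot n i = pclass (quat_rels n) (qnf (i, False))"

definition flip :: "nat \<Rightarrow> nat \<Rightarrow> quat_gen gword set" where
  "flip n i = pclass (quat_rels n) (qnf (i, True))"

definition noncentral_rots :: "nat \<Rightarrow> quat_gen gword set list" where
  "noncentral_rots n = map (rot n) ([1..<n] @ [n + 1..<2 * n])"

definition flip_pairs :: "nat \<Rightarrow> quat_gen gword set list list" where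
  "flip_pairs n = map (\<lambda>j. [flip n j, flip n (j + n)]) [0..<n]"

text \<open>The order of this list follows the decomposition of the graph: two dominating vertices, a
  clique, and \<open>n\<close> edges.\<close>

definition quat_vertices :: "nat \<Rightarrow> quat_gen gword set list" where
  "quat_vertices n = rot n 0 # rot n n # noncentral_rots n @ concat (flip_pairs n)"

text \<open>Distinct normal forms act differently on the pair \<open>(0, False)\<close>, and every word has a normal
  form with exponent below \<open>2n\<close>; comparing the actions shows that this exponent is \<open>i mod 2n\<close>.\<close>

lemma pclass_qnf_eq_iff:
  assumes "n > 0"
  shows "pclass (quat_rels n) (qnf (i, s)) = pclass (quat_rels n) (qnf (j, t))
    \<longleftrightarrow> i mod (2 * n) = j mod (2 * n) \<and> s = t"
    (is "?c i s = ?c j t \<longleftrightarrow> _")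
proof -
  have dom: "(0, b) \<in> qdom n" for b using assms by (simp add: qdom_def)
  have val: "foldr (qact n) (qnf (i, s)) (0, False) = (int (i mod (2 * n)), s)" for i s
    using dom by (auto simp: qnf_def qact_a_power zmod_int)
  have normal_form_unique: "i mod (2 * n) = j mod (2 * n) \<and> s = t" if "?c i s = ?c j t" for i s j t
  proof -
    from that have "foldr (qact n) (qnf (i, s)) (0, False) = foldr (qact n) (qnf (j, t)) (0, False)"
      using assms dom by (intro pcong_imp_qact_eq) (simp_all add: pclass_eq_iff)
    then show ?thesis unfolding val by (simp only: prod.inject of_nat_eq_iff)
  qed
  have red: "?c i s = ?c (i mod (2 * n)) s" for i s
  proof -
    obtain k u where "k < 2 * n" "?c i s = ?c k u"
      using has_qnf[OF assms, of "qnf (i, s)"] by (auto simp: has_qnf_def pclass_eq_iff)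
    with normal_form_unique[of i s k u] show ?thesis by simp
  qed
  show ?thesis
  proof
    assume eq: "i mod (2 * n) = j mod (2 * n) \<and> s = t"
    have "?c i s = ?c (i mod (2 * n)) s" by (rule red)
    also have "\<dots> = ?c (j mod (2 * n)) t" using eq by simp
    also have "\<dots> = ?c j t" by (rule red[symmetric])
    finally show "?c i s = ?c j t" .
  qed (rule normal_form_unique)
qed

lemma enhanced_power_adj_commute:
  "enhanced_power_adj G x y \<longleftrightarrow> enhanced_power_adj G y x"
  unfolding enhanced_power_adj_def by auto

context
  fixes n :: nat
  assumes n: "n > 0"
begin

interpretation group "quaternion_group n"
  unfolding quaternion_group_def by (rule group_presented_group)

lemma rot_eq_iff: "rot n i = rot n j \<longleftrightarrow> i mod (2 * n) = j mod (2 * n)"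
  and flip_eq_iff: "flip n i = flip n j \<longleftrightarrow> i mod (2 * n) = j mod (2 * n)"
  and rot_neq_flip: "rot n i \<noteq> flip n j" "flip n j \<noteq> rot n i"
  unfolding rot_def flip_def by (simp_all add: pclass_qnf_eq_iff[OF n])

lemma rot_in_carrier [simp]: "rot n i \<in> carrier (quaternion_group n)"
  and flip_in_carrier [simp]: "flip n i \<in> carrier (quaternion_group n)"
  by (simp_all add: rot_def flip_def quaternion_group_def presented_group_def)

lemma carrier_quaternion_cases:
  assumes "x \<in> carrier (quaternion_group n)"
  obtains i where "i < 2 * n" "x = rot n i" | i where "i < 2 * n" "x = flip n i"
proof -
  obtain w where w: "x = pclass (quat_rels n) w"
    using assms by (auto simp: quaternion_group_def presented_group_def)
  obtain i s where "i < 2 * n" "x = pclass (quat_rels n) (qnf (i, s))"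
    using has_qnf[OF n, of w] by (auto simp: has_qnf_def w pclass_eq_iff)
  then show ?thesis using that by (cases s) (auto simp: rot_def flip_def)
qed

lemma one_quaternion: "\<one>\<^bsub>quaternion_group n\<^esub> = rot n 0"
  by (simp add: rot_def qnf_def quaternion_group_def presented_group_def)

lemma rot_mult_rot: "rot n i \<otimes>\<^bsub>quaternion_group n\<^esub> rot n j = rot n (i + j)"
  and rot_mult_flip: "rot n i \<otimes>\<^bsub>quaternion_group n\<^esub> flip n j = flip n (i + j)"
  by (simp_all add: rot_def flip_def quaternion_group_def presented_group_mult qnf_def replicate_add)

text \<open>Conjugation by \<open>b\<close> inverts \<open>a\<close>, so in \<open>a\<^sup>i b a\<^sup>i b\<close> the powers of \<open>a\<close> cancel one letter at a
  time, and \<open>b\<^sup>2 = a\<^sup>n\<close> remains.\<close>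

lemma flip_square: "flip n i \<otimes>\<^bsub>quaternion_group n\<^esub> flip n i = rot n n"
proof -
  let ?R = "quat_rels n" and ?a = "(Gen_a, False)" and ?A = "(Gen_a, True)" and ?b = "(Gen_b, False)"
  have "pcong ?R (qnf (i, True) @ qnf (i, True)) [?b, ?b]"
  proof (induction i)
    case 0
    show ?case by (simp add: qnf_def pcong.refl)
  next
    case (Suc i)
    have "pcong ?R (replicate i ?a @ [?a, ?b] @ (?a # qnf (i, True)))
        (replicate i ?a @ [?b, ?A] @ (?a # qnf (i, True)))"
      by (rule pcong.ctxt[OF quat_rel3])
    moreover have "pcong ?R ((replicate i ?a @ [?b]) @ [?A, ?a] @ qnf (i, True))
        ((replicate i ?a @ [?b]) @ [] @ qnf (i, True))"
      using pcong.cancel[of ?R Gen_a True] by (intro pcong.ctxt) simp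
    ultimately have "pcong ?R (replicate i ?a @ [?a, ?b] @ (?a # qnf (i, True)))
        (qnf (i, True) @ qnf (i, True))"
      by (auto simp: qnf_def intro: pcong.trans)
    moreover have "replicate i ?a @ [?a, ?b] @ (?a # qnf (i, True)) = qnf (Suc i, True) @ qnf (Suc i, True)"
      by (simp add: qnf_def replicate_app_Cons_same)
    ultimately show ?case using Suc by (auto intro: pcong.trans)
  qed
  moreover have "pcong ?R [?b, ?b] (qnf (n, False))"
    using quat_rel2[of n] by (simp add: qnf_def pcong.sym)
  ultimately show ?thesis
    by (auto simp: rot_def flip_def quaternion_group_def presented_group_mult pclass_eq_iff
        intro: pcong.trans)
qed

text \<open>In a finite group the powers with natural exponents already exhaust a cyclic subgroup, so
  closure under inverses need not be checked.\<close>

lemma generate_subset_if_closed: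
  assumes "z \<in> carrier (quaternion_group n)" "rot n 0 \<in> H"
    and "\<And>h. h \<in> H \<Longrightarrow> h \<otimes>\<^bsub>quaternion_group n\<^esub> z \<in> H"
  shows "generate (quaternion_group n) {z} \<subseteq> H"
proof -
  have "finite (carrier (quaternion_group n))"
    using card_quaternion_group[OF n] n by (intro card_ge_0_finite) simp
  moreover have "z [^]\<^bsub>quaternion_group n\<^esub> k \<in> H" for k :: nat
    using assms by (induction k) (auto simp: one_quaternion)
  ultimately show ?thesis using generate_pow_on_finite_carrier assms(1) by auto
qed

lemma generate_rot: "generate (quaternion_group n) {rot n k} \<subseteq> range (rot n)"
  by (rule generate_subset_if_closed) (auto simp: rot_mult_rot)

lemma generate_rot_1: "rot n i \<in> generate (quaternion_group n) {rot n 1}"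
proof (induction i)
  case 0
  show ?case using generate.one[of "quaternion_group n"] by (simp add: one_quaternion)
next
  case (Suc i)
  then have "rot n i \<otimes>\<^bsub>quaternion_group n\<^esub> rot n 1 \<in> generate (quaternion_group n) {rot n 1}"
    by (rule generate.eng) (simp add: generate.incl)
  then show ?case by (simp add: rot_mult_rot)
qed

text \<open>With \<open>g = a\<^sup>k b\<close>, the listed elements are \<open>g\<^sup>4 = e\<close>, \<open>g\<^sup>2\<close>, \<open>g\<close> and \<open>g\<^sup>3\<close>.\<close>

lemma generate_flip:
  "generate (quaternion_group n) {flip n k} = {rot n 0, rot n n, flip n k, flip n (k + n)}"
proof
  let ?H = "{rot n 0, rot n n, flip n k, flip n (k + n)}"
  have "rot n (n + n) = rot n 0" by (simp add: rot_eq_iff flip: mult_2)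
  moreover have flip_k_n: "rot n n \<otimes>\<^bsub>quaternion_group n\<^esub> flip n k = flip n (k + n)"
    by (simp only: rot_mult_flip add.commute)
  ultimately have "flip n (k + n) \<otimes>\<^bsub>quaternion_group n\<^esub> flip n k = rot n 0"
    using m_assoc[of "rot n n" "flip n k" "flip n k"] by (simp add: flip_square rot_mult_rot)
  moreover have "rot n 0 \<otimes>\<^bsub>quaternion_group n\<^esub> flip n k = flip n k"
    by (simp add: rot_mult_flip)
  ultimately have "h \<otimes>\<^bsub>quaternion_group n\<^esub> flip n k \<in> ?H" if "h \<in> ?H" for h
    using that flip_k_n flip_square[of k] by (elim insertE emptyE) simp_all
  then show "generate (quaternion_group n) {flip n k} \<subseteq> ?H"
    by (intro generate_subset_if_closed) simp_all
next
  let ?S = "generate (quaternion_group n) {flip n k}"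
  have 1: "flip n k \<in> ?S" by (simp add: generate.incl)
  then have 2: "rot n n \<in> ?S" using generate.eng[OF 1 1] by (simp add: flip_square)
  then have "flip n (k + n) \<in> ?S" using generate.eng[OF 2 1] by (simp add: rot_mult_flip add.commute)
  moreover have "rot n 0 \<in> ?S" using generate.one[of "quaternion_group n"] by (simp add: one_quaternion)
  ultimately show "{rot n 0, rot n n, flip n k, flip n (k + n)} \<subseteq> ?S" using 1 2 by simp
qed

section \<open>The enhanced power graph\<close>

lemma mod_eq_iff_mod_double:
  "i mod n = j mod n \<longleftrightarrow> i mod (2 * n) = j mod (2 * n) \<or> i mod (2 * n) = (j + n) mod (2 * n)"
proof -
  have m: "i mod (2 * n) = n * (i div n mod 2) + i mod n" for i
    using mod_mult2_eq[of i n 2] by (simp add: mult.commute)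
  have p: "(j + n) div n = j div n + 1" "(j + n) mod n = j mod n" using n by simp_all
  have "i mod n = i mod (2 * n) mod n" for i by (simp add: mod_mod_cancel)
  moreover have "x mod 2 = y mod 2 \<or> x mod 2 = (y + 1) mod 2" for x y :: nat by presburger
  ultimately show ?thesis unfolding m p by (metis m p mod_mod_trivial)
qed

lemma adj_rot_rot:
  "enhanced_power_adj (quaternion_group n) (rot n i) (rot n j) \<longleftrightarrow> rot n i \<noteq> rot n j"
  unfolding enhanced_power_adj_def using generate_rot_1 rot_in_carrier by blast

text \<open>A cyclic subgroup that contains \<open>a\<^sup>j b\<close> is generated by some \<open>a\<^sup>k b\<close>, hence meets the powers
  of \<open>a\<close> only in \<open>e\<close> and \<open>a\<^sup>n\<close>.\<close>

lemma adj_rot_flip: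
  "enhanced_power_adj (quaternion_group n) (rot n i) (flip n j) \<longleftrightarrow> i mod n = 0"
proof
  assume "enhanced_power_adj (quaternion_group n) (rot n i) (flip n j)"
  then obtain z where z: "z \<in> carrier (quaternion_group n)"
    "rot n i \<in> generate (quaternion_group n) {z}" "flip n j \<in> generate (quaternion_group n) {z}"
    unfolding enhanced_power_adj_def by auto
  from z(1) show "i mod n = 0"
  proof (cases rule: carrier_quaternion_cases)
    case (1 k)
    then show ?thesis using z(3) generate_rot[of k] rot_neq_flip by auto
  next
    case (2 k)
    then have "rot n i = rot n 0 \<or> rot n i = rot n n"
      using z(2) rot_neq_flip by (auto simp: generate_flip)
    then show ?thesis using mod_eq_iff_mod_double[of i 0] by (simp add: rot_eq_iff)
  qed
next
  assume "i mod n = 0"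
  then have "rot n i = rot n 0 \<or> rot n i = rot n n"
    using mod_eq_iff_mod_double[of i 0] by (simp add: rot_eq_iff)
  then show "enhanced_power_adj (quaternion_group n) (rot n i) (flip n j)"
    unfolding enhanced_power_adj_def
    by (auto simp: rot_neq_flip generate_flip intro!: bexI[of _ "flip n j"])
qed

lemma adj_flip_rot:
  "enhanced_power_adj (quaternion_group n) (flip n j) (rot n i) \<longleftrightarrow> i mod n = 0"
  by (subst enhanced_power_adj_commute) (rule adj_rot_flip)

lemma adj_flip_flip:
  "enhanced_power_adj (quaternion_group n) (flip n i) (flip n j)
    \<longleftrightarrow> flip n i \<noteq> flip n j \<and> i mod n = j mod n"
proof
  assume adj: "enhanced_power_adj (quaternion_group n) (flip n i) (flip n j)"
  then obtain z where z: "z \<in> carrier (quaternion_group n)"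
    "flip n i \<in> generate (quaternion_group n) {z}" "flip n j \<in> generate (quaternion_group n) {z}"
    unfolding enhanced_power_adj_def by auto
  from z(1) have "i mod n = j mod n"
  proof (cases rule: carrier_quaternion_cases)
    case (1 k)
    then show ?thesis using z(3) generate_rot[of k] rot_neq_flip by auto
  next
    case (2 k)
    then have "flip n i = flip n k \<or> flip n i = flip n (k + n)"
      "flip n j = flip n k \<or> flip n j = flip n (k + n)"
      using z(2,3) rot_neq_flip by (auto simp: generate_flip)
    then have "i mod n = k mod n" "j mod n = k mod n"
      by (simp_all only: flip_eq_iff mod_eq_iff_mod_double)
    then show ?thesis by simp
  qed
  then show "flip n i \<noteq> flip n j \<and> i mod n = j mod n"
    using adj by (simp add: enhanced_power_adj_def)
next
  assume *: "flip n i \<noteq> flip n j \<and> i mod n = j mod n"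
  then have "flip n i = flip n (j + n)"
    using mod_eq_iff_mod_double[of i j] by (auto simp: flip_eq_iff)
  then have "flip n i \<in> generate (quaternion_group n) {flip n j}"
    "flip n j \<in> generate (quaternion_group n) {flip n j}"
    by (simp_all add: generate_flip)
  then show "enhanced_power_adj (quaternion_group n) (flip n i) (flip n j)"
    using * flip_in_carrier unfolding enhanced_power_adj_def by blast
qed

text \<open>The list covers the group and its length equals the order of the group, so it has no
  repetitions.\<close>

lemma quat_vertices:
  "set (quat_vertices n) = carrier (quaternion_group n)" "distinct (quat_vertices n)"
  "length (quat_vertices n) = 4 * n"
proof -
  have R: "rot n i \<in> set (quat_vertices n)" if "i < 2 * n" for i
  proof -
    have "i \<in> {0, n} \<union> {1..<n} \<union> {n + 1..<2 * n}" using that by auto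
    then show ?thesis by (auto simp: quat_vertices_def noncentral_rots_def)
  qed
  have F: "flip n i \<in> set (quat_vertices n)" if "i < 2 * n" for i
  proof (cases "i < n")
    case False
    then have "flip n i \<in> {flip n (i - n), flip n (i - n + n)}" "i - n \<in> {0..<n}"
      using that by simp_all
    then have "flip n i \<in> (\<Union>j\<in>{0..<n}. {flip n j, flip n (j + n)})" by (rule UN_I[rotated])
    then show ?thesis by (simp add: quat_vertices_def flip_pairs_def)
  qed (auto simp: quat_vertices_def flip_pairs_def)
  have "carrier (quaternion_group n) \<subseteq> set (quat_vertices n)"
    using R F by (auto elim: carrier_quaternion_cases)
  moreover have "set (quat_vertices n) \<subseteq> carrier (quaternion_group n)"
    by (auto simp: quat_vertices_def noncentral_rots_def flip_pairs_def)
  ultimately show S: "set (quat_vertices n) = carrier (quaternion_group n)" by blast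
  have "length (concat (flip_pairs n)) = 2 * n"
    by (simp add: flip_pairs_def length_concat comp_def sum_list_triv)
  then show L: "length (quat_vertices n) = 4 * n"
    using n by (simp add: quat_vertices_def noncentral_rots_def)
  show "distinct (quat_vertices n)"
    by (rule card_distinct) (simp add: S L card_quaternion_group[OF n])
qed

end

section \<open>The Laplacian characteristic polynomial\<close>

theorem theorem4p4:
  fixes n :: nat and vs :: "quat_gen gword set list"
  assumes "n \<ge> 1"
    and "distinct vs" and "set vs = carrier (quaternion_group n)"
  shows "to_fract (char_poly (laplacian_mat vs (enhanced_power_adj (quaternion_group n)))) =
    to_fract [:0, 1:] * to_fract [:- of_nat (4 * n), 1:] ^ 2 * to_fract [:- 4, 1:] ^ n
      * to_fract [:- 2, 1:] ^ n * to_fract [:- of_nat (2 * n), 1:] powi (2 * int n - 3)"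
proof -
  let ?E = "enhanced_power_adj (quaternion_group n)"
  \<comment> \<open>The linear factor with root \<open>c\<close>; deleting a dominating vertex turns \<open>l c\<close> into \<open>l (c + 1)\<close>.\<close>
  define l :: "real \<Rightarrow> real poly" where "l c = [:- c, 1:]" for c
  define F where "F = lap_char (l 2) ?E (noncentral_rots n)"
  have n: "n > 0" using assms(1) by simp
  note adj = adj_rot_rot[OF n] adj_rot_flip[OF n] adj_flip_rot[OF n] adj_flip_flip[OF n]
  have l_diff: "l c - of_nat k = l (c + real k)" "l c - 1 = l (c + 1)" for c k
    by (simp_all add: l_def of_nat_poly one_pCons)
  have l_nz: "l c \<noteq> 0" "l c \<notin> \<nat>" for c
    by (auto simp: l_def Nats_def of_nat_poly)
  have central: "?E (rot n i) w \<and> ?E w (rot n i)"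
    if "i = 0 \<or> i = n" "w \<in> carrier (quaternion_group n)" "w \<noteq> rot n i" for i w
    using that(2) by (cases rule: carrier_quaternion_cases[OF n]) (use that adj in auto)
  \<comment> \<open>The components left after two deletions are evaluated at \<open>l 0 - 2 = l 2\<close>.\<close>
  have clique: "(l 2 - of_nat (2 * n - 2)) * F = l 2 * (l 2 - of_nat (2 * n - 2)) ^ (2 * n - 2)"
  proof -
    have "length (noncentral_rots n) = 2 * n - 2" using n by (simp add: noncentral_rots_def)
    moreover have "distinct (noncentral_rots n)"
      using quat_vertices(2)[OF n] by (simp add: quat_vertices_def)
    moreover have "?E x y \<longleftrightarrow> x \<noteq> y"
      if "x \<in> set (noncentral_rots n)" "y \<in> set (noncentral_rots n)" for x y
      using that by (auto simp: noncentral_rots_def adj)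
    ultimately show ?thesis
      unfolding F_def using lap_char_clique[of "l 2" "noncentral_rots n" ?E] l_nz(2) by simp
  qed
  have pair: "lap_char (l 2) ?E [flip n j, flip n (j + n)] = l 2 * l 4" for j
  proof -
    have "\<not> 2 * n dvd n" using n by (auto dest: dvd_imp_le)
    then have "flip n (j + n) \<noteq> flip n j"
      using mod_eq_dvd_iff_nat[of j "j + n" "2 * n"] by (simp add: flip_eq_iff[OF n])
    then have "distinct [flip n j, flip n (j + n)]" by simp
    moreover have "?E x y \<longleftrightarrow> x \<noteq> y"
      if "x \<in> set [flip n j, flip n (j + n)]" "y \<in> set [flip n j, flip n (j + n)]" for x y
      using that unfolding list.set insert_iff empty_iff by (elim disjE) (simp_all add: adj)
    ultimately have "(l 2 - of_nat (Suc (Suc 0))) * lap_char (l 2) ?E [flip n j, flip n (j + n)]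
        = l 2 * (l 2 - of_nat (Suc (Suc 0))) ^ Suc (Suc 0)"
      using lap_char_clique[of "l 2" "[flip n j, flip n (j + n)]" ?E] l_nz(2)
      by (simp del: of_nat_Suc power_Suc)
    then show ?thesis using l_nz(1)[of 4] by (simp only: l_diff) (simp add: power2_eq_square)
  qed
  have "sorted_wrt (\<lambda>xs ys. \<forall>x\<in>set xs. \<forall>y\<in>set ys. \<not> ?E x y \<and> \<not> ?E y x) (flip_pairs n)"
    unfolding flip_pairs_def sorted_wrt_map
    by (rule sorted_wrt_mono_rel[OF _ sorted_wrt_upt]) (auto simp: adj)
  then have pairs: "lap_char (l 2) ?E (concat (flip_pairs n)) = (l 2 * l 4) ^ n"
    by (simp add: lap_char_concat flip_pairs_def comp_def pair map_replicate_const)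
  have noncentral: "\<not> n dvd i" if "i \<in> {1..<n} \<union> {n + 1..<2 * n}" for i
    using that by (auto simp: le_mod_geq dvd_eq_mod_eq_0 simp del: mod_greater_zero_iff_not_dvd)
  have rest: "lap_char (l 2) ?E (noncentral_rots n @ concat (flip_pairs n)) = F * (l 2 * l 4) ^ n"
    unfolding F_def pairs[symmetric]
    by (rule lap_char_append) (use noncentral in \<open>auto simp: noncentral_rots_def flip_pairs_def adj\<close>)
  have V: "set (rot n n # noncentral_rots n @ concat (flip_pairs n)) \<subseteq> carrier (quaternion_group n)"
    "distinct (rot n 0 # rot n n # noncentral_rots n @ concat (flip_pairs n))"
    "length (rot n 0 # rot n n # noncentral_rots n @ concat (flip_pairs n)) = 4 * n"
    using quat_vertices[OF n] unfolding quat_vertices_def by auto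
  have irrefl: "\<not> ?E x x" for x by (simp add: enhanced_power_adj_def)
  \<comment> \<open>The two deletions, of \<open>e\<close> from \<open>4n\<close> vertices and of \<open>a\<^sup>n\<close> from the remaining \<open>4n - 1\<close>.\<close>
  have d1: "(l 0 - 1) * lap_char (l 0) ?E (quat_vertices n) = l 0 * (l 0 - of_nat (4 * n))
      * lap_char (l 0 - 1) ?E (rot n n # noncentral_rots n @ concat (flip_pairs n))"
    unfolding quat_vertices_def V(3)[symmetric]
    by (rule lap_char_dominating[OF enhanced_power_adj_commute irrefl]) (use V in \<open>intro central; auto\<close>)
  have len: "length (rot n n # noncentral_rots n @ concat (flip_pairs n)) = 4 * n - 1"
    using V(3) by simp
  have d2: "(l 1 - 1) * lap_char (l 1) ?E (rot n n # noncentral_rots n @ concat (flip_pairs n))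
      = l 1 * (l 1 - of_nat (4 * n - 1))
      * lap_char (l 1 - 1) ?E (noncentral_rots n @ concat (flip_pairs n))"
    unfolding len[symmetric]
    by (rule lap_char_dominating[OF enhanced_power_adj_commute irrefl]) (use V in \<open>intro central; auto\<close>)
  define P where "P = char_poly (laplacian_mat vs ?E)"
  have "mset vs = mset (quat_vertices n)"
    using set_eq_iff_mset_eq_distinct[OF assms(2) quat_vertices(2)[OF n]]
    unfolding assms(3) quat_vertices(1)[OF n] by simp
  then have P: "P = lap_char (l 0) ?E (quat_vertices n)"
    unfolding P_def char_poly_laplacian_mat[OF assms(2)] l_def minus_zero by (rule lap_char_mset_cong)
  have real_n: "1 + real (4 * n - 1) = real (4 * n)" "2 + real (2 * n - 2) = real (2 * n)"
    using n by (simp_all add: of_nat_diff)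
  define Q where "Q = lap_char (l 1) ?E (rot n n # noncentral_rots n @ concat (flip_pairs n))"
  have P_Q: "l 1 * P = l 0 * l (real (4 * n)) * Q"
    using d1 unfolding P Q_def l_diff by (simp only: add_0)
  have Q_F: "l 2 * Q = l 1 * l (real (4 * n)) * (F * (l 2 * l 4) ^ n)"
    using d2 unfolding Q_def l_diff real_n one_add_one rest .
  have "l 1 * (l 2 * P) = l 0 * l (real (4 * n)) * (l 2 * Q)"
    using P_Q by (simp add: mult_ac del: of_nat_mult)
  also have "\<dots> = l 1 * (l 0 * l (4 * n) ^ 2 * (F * (l 2 * l 4) ^ n))"
    unfolding Q_F by (simp add: power2_eq_square mult_ac)
  finally have "l 1 * (l 2 * P) = l 1 * (l 0 * l (4 * n) ^ 2 * (F * (l 2 * l 4) ^ n))" .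
  then have main: "l 2 * P = l 0 * l (4 * n) ^ 2 * (F * (l 2 * l 4) ^ n)"
    using l_nz(1) by (simp only: mult_cancel_left) simp
  have F: "l (2 * n) * F = l 2 * l (2 * n) ^ (2 * n - 2)"
    using clique by (simp only: l_diff real_n)
  \<comment> \<open>Cancelling \<open>l 2\<close> keeps everything polynomial. Division by \<open>l (2 * n)\<close> has to wait for the
    fraction field, since for \<open>n = 1\<close> the exponent \<open>2 * n - 3\<close> is negative.\<close>
  have "l 2 * (l (2 * n) * P) = l 0 * l (4 * n) ^ 2 * (l (2 * n) * F) * (l 2 * l 4) ^ n"
    using main by (simp add: mult_ac)
  also have "\<dots> = l 2 * (l 0 * l (4 * n) ^ 2 * l 4 ^ n * l 2 ^ n * l (2 * n) ^ (2 * n - 2))"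
    unfolding F by (simp add: power_mult_distrib mult_ac)
  finally have "l (2 * n) * P = l 0 * l (4 * n) ^ 2 * l 4 ^ n * l 2 ^ n * l (2 * n) ^ (2 * n - 2)"
    using l_nz(1) by (simp only: mult_cancel_left) simp
  moreover have "to_fract (p ^ k) = to_fract p ^ k" for p :: "real poly" and k
    by (induction k) simp_all
  ultimately have "to_fract (l (2 * n)) * to_fract P = to_fract (l 0) * to_fract (l (4 * n)) ^ 2
      * to_fract (l 4) ^ n * to_fract (l 2) ^ n * to_fract (l (2 * n)) ^ (2 * n - 2)"
    by (metis to_fract_mult)
  moreover have nz: "to_fract (l (2 * n)) \<noteq> 0" using l_nz(1) by simp
  moreover have "to_fract (l (2 * n)) powi (2 * int n - 3)
      = to_fract (l (2 * n)) ^ (2 * n - 2) / to_fract (l (2 * n))"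
  proof -
    have "2 * int n - 3 = int (2 * n - 2) - 1" using n by (simp add: of_nat_diff)
    then show ?thesis
      using power_int_diff[OF disjI1[OF nz], of "int (2 * n - 2)" 1]
      by (simp only: power_int_of_nat power_int_1_right)
  qed
  moreover have "p = c * w" if "y * p = c * z" "y \<noteq> 0" "w = z / y"
    for p c w y z :: "real poly fract"
  proof -
    have "p = y * p / y" using that(2) by simp
    then show ?thesis unfolding that(1,3) by simp
  qed
  ultimately have "to_fract P = to_fract (l 0) * to_fract (l (4 * n)) ^ 2 * to_fract (l 4) ^ n
      * to_fract (l 2) ^ n * to_fract (l (2 * n)) powi (2 * int n - 3)"
    by blast
  then show ?thesis by (simp add: P_def l_def)
qed

end
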